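(* Let $\theta(n)$ denote the maximum interval colouring thickness of a graph on $n$ vertices and $\theta'(m)$ the maximum interval colouring thickness of a graph with $m$ edges. Then $\theta(n)\le n^{5/6+o(1)}$ as $n\to\infty$ and $\theta'(m)\le m^{5/11+o(1)}$ as $m\to\infty$.
   Context: All graphs are finite and simple. An interval colouring of a graph $G$ is a proper edge-colouring $c\colon E(G)\to\mathbb{N}$ such that for every vertex $v$, the set $\{c(vw): w\in N(v)\}$ of colours on edges incident to $v$ is a set of consecutive integers. $G$ is interval colourable if it has an interval colouring. The interval colouring thickness $\theta(G)$ is the minimum $k$ such that $E(G)$ can be partitioned into $k$ sets each spanning an interval colourable subgraph. *)

theory Defs
  imports Complex_Main
begin

text \<open>A finite simple graph is represented by its edge set: a finite set of
2-element vertex sets (vertices are natural numbers). Isolated vertices play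
no role for interval colourings.\<close>

definition simple_graph :: "nat set set \<Rightarrow> bool" where
  "simple_graph E \<longleftrightarrow> finite E \<and> (\<forall>e\<in>E. card e = 2)"

definition interval_colouring :: "nat set set \<Rightarrow> (nat set \<Rightarrow> nat) \<Rightarrow> bool" where
  "interval_colouring E c \<longleftrightarrow>
     (\<forall>e\<in>E. \<forall>e'\<in>E. e \<noteq> e' \<and> e \<inter> e' \<noteq> {} \<longrightarrow> c e \<noteq> c e') \<and>
     (\<forall>v. \<exists>a b. c ` {e\<in>E. v \<in> e} = {a..b})"

definition interval_colourable :: "nat set set \<Rightarrow> bool" where
  "interval_colourable E \<longleftrightarrow> (\<exists>c. interval_colouring E c)"

definition ic_thickness :: "nat set set \<Rightarrow> nat" where
  "ic_thickness E = (LEAST k. \<exists>p :: nat set \<Rightarrow> nat. p ` E \<subseteq> {..<k} \<and>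
       (\<forall>i<k. interval_colourable {e\<in>E. p e = i}))"

definition theta_v :: "nat \<Rightarrow> nat" where
  "theta_v n = Max (ic_thickness ` {E. simple_graph E \<and> (\<forall>e\<in>E. e \<subseteq> {0..<n})})"

definition theta_e :: "nat \<Rightarrow> nat" where
  "theta_e m = Max (ic_thickness ` {E. simple_graph E \<and> card E = m})"

end

theory Submission
  imports Defs
begin

text \<open>A union of disjoint perfect matchings between \<open>U\<close> and \<open>W\<close>, one colour for each, is interval
  coloured. In a bipartite graph choose \<open>U\<close> and \<open>W\<close>, both of size \<open>N\<close>, so that the number \<open>e\<close>
  of edges between them divided by \<open>N\<close> to the \<open>5/3\<close> is maximal. Then the pair is regular enough for
  Hall's condition to survive the deletion of \<open>e / (100 N)\<close> perfect matchings. Hence a graph with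
  \<open>n\<close> vertices and \<open>m\<close> edges has an interval colourable subgraph with at least a constant times
  \<open>m^6 / n^10\<close> edges. Removing such subgraphs until \<open>n\<close> to the \<open>11/6\<close> edges are left takes
  \<open>O(n^(5/6))\<close> steps. Peeling off vertices of degree \<open>O(n^(5/6))\<close> splits the rest into that many
  forests, which are interval colourable, and a core with at most \<open>n / 2\<close> vertices, to which the
  argument is applied again. The bound in \<open>m\<close> follows by first peeling off vertices of degree at
  most \<open>m\<close> to the \<open>5/11\<close>, which leaves a core with \<open>O(m^(6/11))\<close> vertices.\<close>

section \<open>Disjoint perfect matchings\<close>

text \<open>Hall's theorem by induction on \<open>I\<close>. If some nonempty proper subfamily
  \<open>J\<close> is tight, it is matched inside its neighbourhood \<open>X\<close>, and the
  remaining indices still satisfy Hall's condition outside \<open>X\<close>. If no such subfamily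
  exists, every nonempty \<open>K\<close> not containing \<open>i\<close> has at least one neighbour
  to spare, so any choice of \<open>x\<close> for \<open>i\<close> is safe.\<close>

lemma hall_marriage:
  assumes "finite I" "\<And>i. i \<in> I \<Longrightarrow> finite (A i)"
    and "\<And>J. J \<subseteq> I \<Longrightarrow> card J \<le> card (\<Union>(A ` J))"
  shows "\<exists>R. inj_on R I \<and> (\<forall>i\<in>I. R i \<in> A i)"
  using assms
proof (induction I arbitrary: A rule: finite_psubset_induct)
  case (psubset I)
  note fin = psubset.prems(1) and hall = psubset.prems(2)
  show ?case
  proof (cases "\<exists>J. J \<subset> I \<and> J \<noteq> {} \<and> card J = card (\<Union>(A ` J))")
    case True
    then obtain J where J: "J \<subset> I" "J \<noteq> {}" "card J = card (\<Union>(A ` J))" by blast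
    define X where "X = \<Union>(A ` J)"
    have finJ: "finite J" using J(1) psubset.hyps finite_subset by blast
    have finX: "finite X" unfolding X_def using finJ J(1) fin by auto
    have "\<exists>R. inj_on R J \<and> (\<forall>i\<in>J. R i \<in> A i)"
      by (rule psubset.IH[OF J(1)]) (use J(1) fin hall in auto)
    then obtain R1 where R1: "inj_on R1 J" "\<forall>i\<in>J. R1 i \<in> A i" by blast
    have "\<exists>R. inj_on R (I - J) \<and> (\<forall>i\<in>I - J. R i \<in> A i - X)"
    proof (rule psubset.IH)
      show "I - J \<subset> I" using J by blast
      show "finite (A i - X)" if "i \<in> I - J" for i using that fin by auto
      fix K assume K: "K \<subseteq> I - J"
      have finK: "finite K" using K psubset.hyps finite_subset by blast
      have "card K + card J = card (K \<union> J)"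
        using K finK finJ by (subst card_Un_disjoint) auto
      also have "\<dots> \<le> card (\<Union>(A ` (K \<union> J)))" by (rule hall) (use K J in auto)
      also have "\<Union>(A ` (K \<union> J)) = (\<Union>i\<in>K. A i - X) \<union> X" unfolding X_def by auto
      also have "card \<dots> \<le> card (\<Union>i\<in>K. A i - X) + card X" by (rule card_Un_le)
      finally show "card K \<le> card (\<Union>i\<in>K. A i - X)" using J(3) X_def by simp
    qed
    then obtain R2 where R2: "inj_on R2 (I - J)" "\<forall>i\<in>I - J. R2 i \<in> A i - X" by blast
    define R where "R i = (if i \<in> J then R1 i else R2 i)" for i
    have "R1 i \<in> X" if "i \<in> J" for i using R1(2) that unfolding X_def by blast
    then have "R ` J \<subseteq> X" "R ` (I - J) \<inter> X = {}" using R2(2) unfolding R_def by auto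
    moreover have "inj_on R J" "inj_on R (I - J)"
      using R1(1) R2(1) unfolding R_def inj_on_def by auto
    ultimately have "inj_on R (J \<union> (I - J))" unfolding inj_on_Un by auto
    then have "inj_on R I" using J(1) by (simp add: Un_absorb1 psubset_imp_subset)
    moreover have "\<forall>i\<in>I. R i \<in> A i" using R1 R2 unfolding R_def by auto
    ultimately show ?thesis by blast
  next
    case False
    show ?thesis
    proof (cases "I = {}")
      case True then show ?thesis by simp
    next
      case Ine: False
      then obtain i where i: "i \<in> I" by blast
      have "card {i} \<le> card (A i)" using hall[of "{i}"] i by auto
      then have "A i \<noteq> {}" by auto
      then obtain x where x: "x \<in> A i" by blast
      have "\<exists>R. inj_on R (I - {i}) \<and> (\<forall>j\<in>I - {i}. R j \<in> A j - {x})"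
      proof (rule psubset.IH)
        show "I - {i} \<subset> I" using i by blast
        show "finite (A j - {x})" if "j \<in> I - {i}" for j using that fin by auto
        fix K assume K: "K \<subseteq> I - {i}"
        have finK: "finite K" using K psubset.hyps finite_subset by blast
        show "card K \<le> card (\<Union>j\<in>K. A j - {x})"
        proof (cases "K = {}")
          case False
          have "card K < card (\<Union>(A ` K))"
          proof -
            have "card K \<le> card (\<Union>(A ` K))" by (rule hall) (use K in auto)
            moreover have "card K \<noteq> card (\<Union>(A ` K))"
              using \<open>\<not> (\<exists>J. J \<subset> I \<and> J \<noteq> {} \<and> card J = card (\<Union>(A ` J)))\<close> False K i
              by blast
            ultimately show ?thesis by simp
          qed
          also have "card (\<Union>(A ` K)) \<le> card (insert x (\<Union>j\<in>K. A j - {x}))"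
            using finK K fin by (intro card_mono) auto
          also have "\<dots> \<le> Suc (card (\<Union>j\<in>K. A j - {x}))" by (rule card_insert_le_m1) simp_all
          finally show ?thesis by simp
        qed simp
      qed
      then obtain R where R: "inj_on R (I - {i})" "\<forall>j\<in>I - {i}. R j \<in> A j - {x}" by blast
      have "inj_on (R(i := x)) I" using R unfolding inj_on_def by auto
      moreover have "\<forall>j\<in>I. (R(i := x)) j \<in> A j" using R x by auto
      ultimately show ?thesis by blast
    qed
  qed
qed

lemma disjoint_perfect_matchings:
  fixes G :: "('a \<times> 'b) set"
  assumes fin: "finite U" "finite W" and eq: "card U = card W"
    and dense: "\<And>S T. S \<subseteq> U \<Longrightarrow> T \<subseteq> W \<Longrightarrow> card U < card S + card T \<Longrightarrow>
                  r * min (card S) (card T) \<le> card (G \<inter> S \<times> T)"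
  shows "\<exists>f. (\<forall>i<r. bij_betw (f i) U W \<and> (\<forall>u\<in>U. (u, f i u) \<in> G)) \<and>
             (\<forall>i<r. \<forall>j<r. \<forall>u\<in>U. f i u = f j u \<longrightarrow> i = (j::nat))"
proof -
  define Q where "Q k f \<longleftrightarrow> (\<forall>i<k. bij_betw (f i) U W \<and> (\<forall>u\<in>U. (u, f i u) \<in> G)) \<and>
             (\<forall>i<k. \<forall>j<k. \<forall>u\<in>U. f i u = f j u \<longrightarrow> i = (j::nat))" for k and f :: "nat \<Rightarrow> 'a \<Rightarrow> 'b"
  have "k \<le> r \<Longrightarrow> \<exists>f. Q k f" for k
  proof (induction k)
    case 0
    then show ?case by (simp add: Q_def)
  next
    case (Suc k)
    then obtain f where f: "Q k f" by auto
    have bij: "bij_betw (f i) U W" if "i < k" for i using f that by (simp add: Q_def)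
    define A where "A u = {w \<in> W. (u, w) \<in> G \<and> (\<forall>i<k. f i u \<noteq> w)}" for u
    have "\<exists>R. inj_on R U \<and> (\<forall>u\<in>U. R u \<in> A u)"
    proof (rule hall_marriage)
      show "finite U" by fact
      show "finite (A u)" for u using fin by (simp add: A_def)
      fix S assume S: "S \<subseteq> U"
      define T where "T = W - \<Union>(A ` S)"
      have finS: "finite S" "finite T" using S fin finite_subset by (auto simp: T_def)
      have cT: "card T = card W - card (\<Union>(A ` S))" "card (\<Union>(A ` S)) \<le> card W"
        unfolding T_def using fin finite_subset[of "\<Union>(A ` S)" W]
        by (auto simp: A_def intro!: card_Diff_subset card_mono)
      show "card S \<le> card (\<Union>(A ` S))"
      proof (rule ccontr)
        assume "\<not> ?thesis"
        then have big: "card U < card S + card T" using cT eq by linarith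
        have TW: "T \<subseteq> W" by (auto simp: T_def)
        \<comment> \<open>Neither set has more than \<open>card U\<close> elements, so a sum above
          \<open>card U\<close> needs both to be nonempty. This makes the comparison of
          \<open>k\<close> with \<open>r\<close> below strict.\<close>
        have pos: "card S > 0" "card T > 0"
          using big card_mono[OF fin(1) S] card_mono[OF fin(2) TW] eq by linarith+
        have sub: "G \<inter> S \<times> T \<subseteq> (\<Union>i<k. {(u, w). u \<in> S \<and> w \<in> T \<and> f i u = w})"
          unfolding T_def A_def by blast
        have each: "finite {(u, w). u \<in> S \<and> w \<in> T \<and> f i u = w}
            \<and> card {(u, w). u \<in> S \<and> w \<in> T \<and> f i u = w} \<le> min (card S) (card T)"
          if "i < k" for i
        proof -
          let ?M = "{(u, w). u \<in> S \<and> w \<in> T \<and> f i u = w}"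
          have "inj_on fst ?M" by (auto simp: inj_on_def)
          moreover have "fst ` ?M \<subseteq> S" by auto
          ultimately have 1: "card ?M \<le> card S" using card_inj_on_le finS(1) by blast
          have "inj_on snd ?M" using bij[OF that] S by (auto simp: inj_on_def bij_betw_def)
          moreover have "snd ` ?M \<subseteq> T" by auto
          ultimately have 2: "card ?M \<le> card T" using card_inj_on_le finS(2) by blast
          have "finite ?M" by (rule finite_subset[of _ "S \<times> T"]) (use finS in auto)
          with 1 2 show ?thesis by simp
        qed
        have "card (G \<inter> S \<times> T) \<le> card (\<Union>i<k. {(u, w). u \<in> S \<and> w \<in> T \<and> f i u = w})"
          using sub each by (intro card_mono) auto
        also have "\<dots> \<le> (\<Sum>i<k. card {(u, w). u \<in> S \<and> w \<in> T \<and> f i u = w})"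
          by (rule card_UN_le) simp
        also have "\<dots> \<le> (\<Sum>i<k. min (card S) (card T))"
          using each by (intro sum_mono) auto
        also have "\<dots> = k * min (card S) (card T)" by simp
        also have "\<dots> < r * min (card S) (card T)" using Suc.prems pos by simp
        also have "\<dots> \<le> card (G \<inter> S \<times> T)" using dense[OF S TW big] .
        finally show False by simp
      qed
    qed
    then obtain R where R: "inj_on R U" "\<forall>u\<in>U. R u \<in> A u" by blast
    have "R ` U \<subseteq> W" using R by (auto simp: A_def)
    then have "R ` U = W"
      using card_image[OF R(1)] eq fin by (intro card_subset_eq) auto
    then have "bij_betw R U W" using R by (simp add: bij_betw_def)
    then have "Q (Suc k) (f(k := R))"
      using f R unfolding Q_def A_def less_Suc_eq by (auto dest: sym)
    then show ?case by blast
  qed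
  from this[of r] show ?thesis by (simp add: Q_def)
qed

section \<open>Extremal balanced pairs\<close>

text \<open>Deleting an element of least value never lowers the average, so repeated deletion
  reaches a \<open>k\<close>-subset whose average is at least that of \<open>S\<close>. The claim is
  cross-multiplied to avoid division.\<close>

lemma heaviest_subset:
  fixes f :: "'a \<Rightarrow> nat"
  assumes "finite S" "k \<le> card S"
  shows "\<exists>S'\<subseteq>S. card S' = k \<and> k * sum f S \<le> card S * sum f S'"
  using assms
proof (induction S rule: finite_psubset_induct)
  case (psubset S)
  show ?case
  proof (cases "k = card S \<or> k = 0")
    case True
    then show ?thesis
    proof
      assume "k = card S"
      then show ?thesis by (intro exI[of _ S]) auto
    next
      assume "k = 0"
      then show ?thesis by (intro exI[of _ "{}"]) auto
    qed
  next
    case False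
    then have k: "0 < k" "k < card S" using psubset.prems by auto
    then have ne: "S \<noteq> {}" by auto
    define x where "x = arg_min_on f S"
    have x: "x \<in> S" "\<And>y. y \<in> S \<Longrightarrow> f x \<le> f y"
      using arg_min_if_finite(1)[OF psubset.hyps ne, of f]
        arg_min_least[OF psubset.hyps ne, of _ f] by (auto simp: x_def)
    define S1 where "S1 = S - {x}"
    have cS1: "card S = Suc (card S1)" "finite S1"
      unfolding S1_def using card_Suc_Diff1[OF psubset.hyps x(1)] psubset.hyps by simp_all
    have "S1 \<subset> S" using x by (auto simp: S1_def)
    moreover have "k \<le> card S1" using k cS1 by simp
    ultimately obtain S' where S': "S' \<subseteq> S1" "card S' = k" "k * sum f S1 \<le> card S1 * sum f S'"
      using psubset.IH by blast
    have sumS: "sum f S = f x + sum f S1"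
      unfolding S1_def using x(1) psubset.hyps by (simp add: sum.remove)
    have "(\<Sum>y\<in>S1. f x) \<le> sum f S1" by (rule sum_mono) (auto simp: S1_def x(2))
    then have "card S1 * sum f S \<le> card S * sum f S1"
      unfolding sumS cS1 by (simp add: algebra_simps)
    then have "k * (card S1 * sum f S) \<le> k * (card S * sum f S1)" by (rule mult_le_mono2)
    also have "\<dots> = card S * (k * sum f S1)" by simp
    also have "\<dots> \<le> card S * (card S1 * sum f S')" using S'(3) by (rule mult_le_mono2)
    finally have "card S1 * (k * sum f S) \<le> card S1 * (card S * sum f S')"
      by (simp add: algebra_simps)
    moreover have "card S1 > 0" using k cS1 by linarith
    ultimately have "k * sum f S \<le> card S * sum f S'" by simp
    with S' show ?thesis by (auto simp: S1_def)
  qed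
qed

section \<open>Edges of a bipartite graph inside rectangles\<close>

definition rect_edges :: "('a \<times> 'b) set \<Rightarrow> 'a set \<Rightarrow> 'b set \<Rightarrow> nat" where
  "rect_edges G S T = card (G \<inter> S \<times> T)"

lemma rect_edges_converse: "rect_edges (G\<inverse>) T S = rect_edges G S T"
proof -
  have "G\<inverse> \<inter> T \<times> S = prod.swap ` (G \<inter> S \<times> T)" by force
  then show ?thesis unfolding rect_edges_def by (simp add: card_image)
qed

lemma rect_edges_sum_left:
  assumes "finite S" "finite T"
  shows "rect_edges G S T = (\<Sum>u\<in>S. rect_edges G {u} T)"
proof -
  have "G \<inter> S \<times> T = (\<Union>u\<in>S. G \<inter> {u} \<times> T)" by auto
  also have "card \<dots> = (\<Sum>u\<in>S. card (G \<inter> {u} \<times> T))"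
    using assms by (intro card_UN_disjoint) auto
  finally show ?thesis by (simp add: rect_edges_def)
qed

lemma rect_edges_sum_right:
  assumes "finite S" "finite T"
  shows "rect_edges G S T = (\<Sum>w\<in>T. rect_edges G S {w})"
  using rect_edges_sum_left[OF assms(2,1), of "G\<inverse>"] by (simp add: rect_edges_converse)

lemma rect_edges_le:
  assumes "finite S" "finite T"
  shows "rect_edges G S T \<le> card S * card T"
  unfolding rect_edges_def using assms
  by (metis Int_lower2 card_cartesian_product card_mono finite_cartesian_product)

text \<open>Pairs \<open>(U, W)\<close> of size \<open>N\<close> maximising the number \<open>e\<close> of edges divided by \<open>N\<close> to the \<open>5/3\<close>,
  cubed to stay within the natural numbers. The exponent is a compromise: it forces every vertex to
  have nearly \<open>2/3\<close> of the average degree, while a rectangle with a side of length at most \<open>N/2\<close>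
  catches at most a fraction \<open>(1/2)\<close> to the \<open>2/3\<close> (less than \<open>2/3\<close>) of the average degree.\<close>

definition extremal_pair :: "('a \<times> 'b) set \<Rightarrow> 'a set \<Rightarrow> 'b set \<Rightarrow> bool" where
  "extremal_pair G U W \<longleftrightarrow> finite U \<and> finite W \<and> card U = card W \<and>
     (\<forall>S T. S \<subseteq> U \<and> T \<subseteq> W \<and> card S = card T \<longrightarrow>
        rect_edges G S T ^ 3 * card U ^ 5 \<le> rect_edges G U W ^ 3 * card S ^ 5)"

lemma extremal_pair_converse: "extremal_pair G U W \<Longrightarrow> extremal_pair (G\<inverse>) W U"
  unfolding extremal_pair_def rect_edges_converse by metis

text \<open>A root-free form of \<open>(1 - x) powr (5/3) \<le> 1 - 83/50 * x\<close>. It holds for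
  small \<open>x\<close> because \<open>83/50\<close> lies slightly below the slope
  \<open>5/3\<close>; the gap leaves the linear term \<open>x / 50\<close>, which dominates the
  negative quadratic term up to \<open>x = 1/100\<close>.\<close>

lemma one_minus_power_bound:
  fixes x :: real
  assumes "0 \<le> x" "x \<le> 1/100"
  shows "(1 - x) ^ 5 \<le> (1 - 83/50 * x) ^ 3"
proof -
  have "(1 - 83/50 * x) ^ 3 - (1 - x) ^ 5 =
     x * (1/50 - 17332/10000 * x) + x ^ 3 * (5425704/1000000 - 5 * x) + x ^ 5"
    by algebra
  also have "\<dots> \<ge> 0" using assms by (intro add_nonneg_nonneg mult_nonneg_nonneg) auto
  finally show ?thesis by simp
qed

text \<open>Delete \<open>u\<close> together with a vertex \<open>w\<close> of at most average
  degree \<open>e / N\<close>. By extremality at most \<open>e\<close> times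
  \<open>(1 - 1/N)\<close> to the \<open>5/3\<close> edges survive, so at least
  \<open>83/50 * (e / N)\<close> are lost. At most \<open>e / N\<close> of these are at
  \<open>w\<close>, and the other \<open>33/50 * (e / N)\<close> must be at
  \<open>u\<close>.\<close>

lemma extremal_pair_min_degree:
  assumes ext: "extremal_pair G U W" and N: "card U \<ge> 100" and u: "u \<in> U"
  shows "33/50 * (real (rect_edges G U W) / card U) \<le> rect_edges G {u} W"
proof -
  define N where "N = card U"
  define e where "e = rect_edges G U W"
  have fin: "finite U" "finite W" "card W = N" using ext by (auto simp: extremal_pair_def N_def)
  have Npos: "N \<ge> 100" using N by (simp add: N_def)
  then have "W \<noteq> {}" using fin by auto
  have "\<exists>w\<in>W. N * rect_edges G U {w} \<le> e"
  proof (rule ccontr)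
    assume "\<not> ?thesis"
    then have "\<forall>w\<in>W. e < N * rect_edges G U {w}" by (auto simp: not_le)
    then have "(\<Sum>w\<in>W. e) < (\<Sum>w\<in>W. N * rect_edges G U {w})"
      using fin \<open>W \<noteq> {}\<close> by (intro sum_strict_mono) auto
    also have "\<dots> = N * e"
      unfolding e_def rect_edges_sum_right[OF fin(1,2)] by (simp add: sum_distrib_left)
    finally show False using fin by simp
  qed
  then obtain w where w: "w \<in> W" "N * rect_edges G U {w} \<le> e" by blast
  define e' where "e' = rect_edges G (U - {u}) (W - {w})"
  have cards: "card (U - {u}) = N - 1" "card (W - {w}) = N - 1"
    using u w fin by (auto simp: N_def)
  have "e' ^ 3 * N ^ 5 \<le> e ^ 3 * (N - 1) ^ 5"
    using ext cards unfolding extremal_pair_def e'_def e_def N_def[symmetric] by (metis Diff_subset)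
  then have "real (e' ^ 3 * N ^ 5) \<le> real (e ^ 3 * (N - 1) ^ 5)" by (rule of_nat_mono)
  then have "real e' ^ 3 * real N ^ 5 \<le> real e ^ 3 * (real N - 1) ^ 5"
    using Npos by (simp add: of_nat_diff)
  also have "(real N - 1) ^ 5 = (1 - 1 / N) ^ 5 * real N ^ 5"
    using Npos by (simp flip: power_mult_distrib add: algebra_simps)
  finally have "real e' ^ 3 \<le> real e ^ 3 * (1 - 1 / N) ^ 5"
    using Npos by (simp add: mult.assoc[symmetric])
  also have "\<dots> \<le> real e ^ 3 * (1 - 83/50 * (1 / N)) ^ 3"
    using Npos by (intro mult_left_mono one_minus_power_bound) (auto simp: field_simps)
  also have "\<dots> = (real e * (1 - 83/50 * (1 / N))) ^ 3" by (simp add: power_mult_distrib)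
  finally have "real e' ^ 3 \<le> (real e * (1 - 83/50 * (1 / N))) ^ 3" .
  moreover have "0 \<le> real e * (1 - 83/50 * (1 / N))"
    using Npos by (intro mult_nonneg_nonneg) (auto simp: field_simps)
  ultimately have "real e' \<le> real e * (1 - 83/50 * (1 / N))"
    by (subst (asm) power_mono_iff) auto
  then have e': "real e' \<le> real e - 83/50 * (e / N)" by (simp add: algebra_simps)
  have "G \<inter> U \<times> W \<subseteq> (G \<inter> (U - {u}) \<times> (W - {w})) \<union> (G \<inter> {u} \<times> W) \<union> (G \<inter> U \<times> {w})" by auto
  then have "card (G \<inter> U \<times> W) \<le>
      card ((G \<inter> (U - {u}) \<times> (W - {w})) \<union> (G \<inter> {u} \<times> W) \<union> (G \<inter> U \<times> {w}))"
    using fin by (intro card_mono) auto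
  also have "\<dots> \<le> e' + rect_edges G {u} W + rect_edges G U {w}"
    unfolding e'_def rect_edges_def
    by (intro order_trans[OF card_Un_le] add_right_mono card_Un_le)
  finally have "e \<le> e' + rect_edges G {u} W + rect_edges G U {w}"
    by (simp add: e_def rect_edges_def)
  then have "real e \<le> real e' + rect_edges G {u} W + rect_edges G U {w}"
    by linarith
  moreover have "real (rect_edges G U {w}) \<le> e / N"
  proof -
    have "real N * real (rect_edges G U {w}) \<le> real e"
      using w(2) by (metis of_nat_mono of_nat_mult)
    then show ?thesis using Npos by (simp add: field_simps)
  qed
  ultimately show ?thesis using e' unfolding e_def N_def by linarith
qed

text \<open>By the degree bound, \<open>S\<close> sends at least
  \<open>33/50 * (e / N) * card S\<close> edges to \<open>W\<close>. It remains to see that at most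
  \<open>16/25 * (e / N) * card S\<close> of them go to the complement \<open>B\<close> of
  \<open>T\<close>; the difference of the two coefficients is \<open>1/50\<close>.\<close>

lemma extremal_pair_dense_half:
  assumes ext: "extremal_pair G U W" and N: "card U \<ge> 100"
    and S: "S \<subseteq> U" and T: "T \<subseteq> W" and big: "card U < card S + card T"
    and half: "card U \<le> 2 * card T"
  shows "1/50 * (real (rect_edges G U W) / card U) * card S \<le> rect_edges G S T"
proof -
  define N where "N = card U"
  define e where "e = rect_edges G U W"
  have fin: "finite U" "finite W" "card W = N" using ext by (auto simp: extremal_pair_def N_def)
  have finS: "finite S" "finite T" using S T fin finite_subset by auto
  define B where "B = W - T"
  define b where "b = card B"
  have finB: "finite B" using fin by (simp add: B_def)
  have b: "b = N - card T" "card T \<le> N"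
    unfolding b_def B_def using T finS fin card_mono[of W T] by (auto simp: card_Diff_subset)
  have bS: "b \<le> card S" and b2: "2 * b \<le> N" using big half b by (auto simp: N_def)
  have Npos: "N \<ge> 100" using N by (simp add: N_def)
  define x where "x = rect_edges G S B"
  have x: "real x \<le> 16/25 * (e / N) * card S"
  proof (cases "b = 0")
    case True
    then have "B = {}" using finB by (simp add: b_def)
    then show ?thesis by (simp add: x_def rect_edges_def)
  next
    case False
    \<comment> \<open>Extremality speaks of balanced pairs only, so \<open>S\<close> is first cut
      down to its \<open>b\<close> vertices with the most edges into \<open>B\<close>. With
      \<open>b \<le> N / 2\<close> this bounds \<open>x\<close> by \<open>(e / N) * card S\<close>
      times \<open>(1/2)\<close> to the \<open>2/3\<close>.\<close>
    obtain S' where S': "S' \<subseteq> S" "card S' = b"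
      "b * (\<Sum>u\<in>S. rect_edges G {u} B) \<le> card S * (\<Sum>u\<in>S'. rect_edges G {u} B)"
      using heaviest_subset[OF finS(1) bS] by blast
    have finS': "finite S'" using S' finS finite_subset by blast
    have bx: "b * x \<le> card S * rect_edges G S' B"
      using S'(3) unfolding x_def rect_edges_sum_left[OF finS(1) finB]
        rect_edges_sum_left[OF finS' finB] .
    have "B \<subseteq> W" "S' \<subseteq> U" using S S' by (auto simp: B_def)
    then have ex: "rect_edges G S' B ^ 3 * N ^ 5 \<le> e ^ 3 * b ^ 5"
      using ext S'(2) unfolding extremal_pair_def N_def e_def b_def by metis
    have "b ^ 3 * (x ^ 3 * N ^ 5) = (b * x) ^ 3 * N ^ 5" by (simp add: power_mult_distrib)
    also have "\<dots> \<le> (card S * rect_edges G S' B) ^ 3 * N ^ 5"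
      using bx by (intro mult_right_mono power_mono) auto
    also have "\<dots> = card S ^ 3 * (rect_edges G S' B ^ 3 * N ^ 5)" by (simp add: power_mult_distrib)
    also have "\<dots> \<le> card S ^ 3 * (e ^ 3 * b ^ 5)" using ex by (rule mult_left_mono) simp
    also have "\<dots> = b ^ 3 * (card S ^ 3 * e ^ 3 * b ^ 2)"
      by (simp add: power_def algebra_simps numeral_eq_Suc)
    finally have "x ^ 3 * N ^ 5 \<le> card S ^ 3 * e ^ 3 * b ^ 2" using False by simp
    then have "4 * (x ^ 3 * N ^ 5) \<le> card S ^ 3 * e ^ 3 * (2 * b) ^ 2"
      by (simp add: power_mult_distrib)
    also have "\<dots> \<le> card S ^ 3 * e ^ 3 * N ^ 2" using b2 by (intro mult_left_mono power_mono) auto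
    finally have "N ^ 2 * (4 * (x * N) ^ 3) \<le> N ^ 2 * (card S * e) ^ 3"
      by (simp add: power_def algebra_simps numeral_eq_Suc)
    then have "4 * (x * N) ^ 3 \<le> (card S * e) ^ 3" using Npos by simp
    then have "real (4 * (x * N) ^ 3) \<le> real ((card S * e) ^ 3)" by (rule of_nat_mono)
    then have "(real x * N) ^ 3 \<le> 1/4 * (real (card S) * e) ^ 3" by simp
    \<comment> \<open>\<open>16/25\<close> is a rational upper bound for the cube root of
      \<open>1/4\<close>.\<close>
    also have "\<dots> \<le> (16/25) ^ 3 * (real (card S) * e) ^ 3"
      by (intro mult_right_mono) (auto simp: power3_eq_cube)
    also have "\<dots> = (16/25 * (real (card S) * e)) ^ 3" by (rule power_mult_distrib[symmetric])
    finally have "real x * N \<le> 16/25 * (real (card S) * e)"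
      by (subst (asm) power_mono_iff) auto
    then show ?thesis using Npos by (simp add: field_simps)
  qed
  have "33/50 * (e / N) * card S = (\<Sum>u\<in>S. 33/50 * (real e / N))" by simp
  also have "\<dots> \<le> (\<Sum>u\<in>S. real (rect_edges G {u} W))"
    using extremal_pair_min_degree[OF ext N] S unfolding e_def N_def by (intro sum_mono) auto
  also have "\<dots> = rect_edges G S W" by (simp add: rect_edges_sum_left[OF finS(1) fin(2)])
  also have "rect_edges G S W = rect_edges G S T + x"
  proof -
    have "G \<inter> S \<times> W = (G \<inter> S \<times> T) \<union> (G \<inter> S \<times> B)" using T by (auto simp: B_def)
    moreover have "card \<dots> = card (G \<inter> S \<times> T) + card (G \<inter> S \<times> B)"
      using finS finB by (intro card_Un_disjoint) (auto simp: B_def)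
    ultimately show ?thesis by (simp add: rect_edges_def x_def)
  qed
  finally show ?thesis using x unfolding e_def N_def by (simp add: algebra_simps)
qed

text \<open>This is the density condition of \<open>disjoint_perfect_matchings\<close>. As
  \<open>card S + card T\<close> exceeds \<open>card U\<close>, one of the two sets has at least
  half the size of its side; if it is \<open>S\<close>, the previous lemma is applied to the
  converse relation.\<close>

lemma extremal_pair_dense:
  assumes ext: "extremal_pair G U W" and r: "100 * r * card U \<le> rect_edges G U W"
    and S: "S \<subseteq> U" and T: "T \<subseteq> W" and big: "card U < card S + card T"
  shows "r * min (card S) (card T) \<le> rect_edges G S T"
proof (cases "r = 0")
  case False
  have fin: "finite U" "finite W" "card W = card U" using ext by (auto simp: extremal_pair_def)
  have Upos: "card U > 0" using big card_mono[OF fin(1) S] card_mono[OF fin(2) T] fin(3) by linarith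
  \<comment> \<open>For positive \<open>r\<close> the assumption on \<open>r\<close> is compatible
    with at most \<open>card U * card U\<close> edges only if \<open>card U\<close> is at least
    100.\<close>
  have "100 * card U \<le> 100 * r * card U" using False by simp
  also note r
  also have "rect_edges G U W \<le> card U * card U"
    using rect_edges_le[OF fin(1,2), of G] fin(3) by simp
  finally have N: "card U \<ge> 100" using Upos by simp
  have "real (100 * r * card U) \<le> rect_edges G U W" using r by (rule of_nat_mono)
  then have r': "real r \<le> 1/50 * (real (rect_edges G U W) / card U)"
    using Upos by (simp add: field_simps)
  show ?thesis
  proof (cases "card U \<le> 2 * card T")
    case True
    have "real r * card S \<le> 1/50 * (real (rect_edges G U W) / card U) * card S"
      by (intro mult_right_mono r') simp
    also have "\<dots> \<le> rect_edges G S T" by (rule extremal_pair_dense_half[OF ext N S T big True])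
    finally have "r * card S \<le> rect_edges G S T" by (simp flip: of_nat_mult)
    then show ?thesis using mult_le_mono2[of "min (card S) (card T)" "card S" r] by linarith
  next
    case False
    then have half: "card W \<le> 2 * card S" using big fin by linarith
    have "real r * card T \<le> 1/50 * (real (rect_edges (G\<inverse>) W U) / card W) * card T"
      using r' fin(3) by (intro mult_right_mono) (auto simp: rect_edges_converse)
    also have "\<dots> \<le> rect_edges (G\<inverse>) T S"
      by (rule extremal_pair_dense_half[OF extremal_pair_converse[OF ext] _ T S _ half])
        (use fin N big in auto)
    finally have "r * card T \<le> rect_edges G S T"
      by (simp flip: of_nat_mult add: rect_edges_converse)
    then show ?thesis using mult_le_mono2[of "min (card S) (card T)" "card T" r] by linarith
  qed
qed simp

section \<open>A large interval colourable subgraph\<close>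

text \<open>Maximise the cubed ratio over the finitely many nonempty balanced pairs. The comparison
  with all pairs in \<open>A\<close> and \<open>B\<close>, not just those inside \<open>U\<close>
  and \<open>W\<close>, is what later bounds the number of edges of the pair from below.\<close>

lemma extremal_pair_exists:
  assumes fin: "finite A" "finite B" and ne: "A \<noteq> {}" "B \<noteq> {}"
  shows "\<exists>U W. U \<subseteq> A \<and> W \<subseteq> B \<and> U \<noteq> {} \<and> extremal_pair G U W \<and>
    (\<forall>S T. S \<subseteq> A \<and> T \<subseteq> B \<and> card S = card T \<longrightarrow>
        rect_edges G S T ^ 3 * card U ^ 5 \<le> rect_edges G U W ^ 3 * card S ^ 5)"
proof -
  define P where "P = {(S, T). S \<subseteq> A \<and> T \<subseteq> B \<and> card S = card T \<and> S \<noteq> {}}"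
  define h where "h = (\<lambda>(S, T). real (rect_edges G S T) ^ 3 / real (card S) ^ 5)"
  have "finite P"
    by (rule finite_subset[of _ "Pow A \<times> Pow B"]) (use fin in \<open>auto simp: P_def\<close>)
  moreover obtain a b where "a \<in> A" "b \<in> B" using ne by blast
  then have "({a}, {b}) \<in> P" by (auto simp: P_def)
  then have "P \<noteq> {}" by blast
  ultimately have "Max (h ` P) \<in> h ` P" "\<And>q. q \<in> P \<Longrightarrow> h q \<le> Max (h ` P)" by auto
  then obtain U W where UW: "(U, W) \<in> P" and max: "\<And>q. q \<in> P \<Longrightarrow> h q \<le> h (U, W)"
    by force
  have sub: "U \<subseteq> A" "W \<subseteq> B" "card U = card W" "U \<noteq> {}" using UW by (auto simp: P_def)
  have finU: "finite U" "finite W" using sub fin finite_subset by auto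
  have le: "rect_edges G S T ^ 3 * card U ^ 5 \<le> rect_edges G U W ^ 3 * card S ^ 5"
    if S: "S \<subseteq> A" "T \<subseteq> B" "card S = card T" for S T
  proof (cases "S = {}")
    case True
    then show ?thesis by (simp add: rect_edges_def)
  next
    case False
    have "finite S" using S fin finite_subset by blast
    then have "card S > 0" using False by (simp add: card_gt_0_iff)
    moreover have "card U > 0" unfolding card_gt_0_iff using sub finU by blast
    moreover have "h (S, T) \<le> h (U, W)" using False S by (intro max) (auto simp: P_def)
    ultimately have "real (rect_edges G S T) ^ 3 * real (card U) ^ 5
        \<le> real (rect_edges G U W) ^ 3 * real (card S) ^ 5"
      by (simp add: h_def divide_le_eq pos_le_divide_eq field_simps)
    then show ?thesis by (simp flip: of_nat_power of_nat_mult)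
  qed
  have "extremal_pair G U W"
    unfolding extremal_pair_def
    using finU sub le[OF order_trans[OF _ sub(1)] order_trans[OF _ sub(2)]] by simp
  with sub le show ?thesis by (intro exI[of _ U] exI[of _ W]) simp
qed

text \<open>Supplies a comparison pair for the maximum. The larger side is cut down to the size
  \<open>s\<close> of the smaller one, keeping its heaviest vertices, so that at least a fraction
  \<open>s / n\<close> of the edges survives. Its cube times \<open>n ^ 5\<close> is
  \<open>s ^ 3 * n ^ 2\<close>, which is at least \<open>s ^ 5\<close>.\<close>

lemma balanced_pair_exists:
  assumes fin: "finite A" "finite B" and le: "card A \<le> n" "card B \<le> n"
  shows "\<exists>U W. U \<subseteq> A \<and> W \<subseteq> B \<and> card U = card W \<and> card U = min (card A) (card B) \<and>
     rect_edges G A B ^ 3 * card U ^ 5 \<le> rect_edges G U W ^ 3 * n ^ 5"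
proof -
  have main: "\<exists>T'\<subseteq>T. card T' = card S \<and>
     rect_edges K S T ^ 3 * card S ^ 5 \<le> rect_edges K S T' ^ 3 * n ^ 5"
    if fST: "finite S" "finite T" and cST: "card S \<le> card T" "card T \<le> n"
    for S :: "'c set" and T :: "'d set" and K
  proof -
    obtain T' where T': "T' \<subseteq> T" "card T' = card S"
      "card S * (\<Sum>w\<in>T. rect_edges K S {w}) \<le> card T * (\<Sum>w\<in>T'. rect_edges K S {w})"
      using heaviest_subset[OF fST(2) cST(1)] by blast
    have finT': "finite T'" using T'(1) fST(2) finite_subset by blast
    have "card S * rect_edges K S T \<le> card T * rect_edges K S T'"
      using T'(3) unfolding rect_edges_sum_right[OF fST] rect_edges_sum_right[OF fST(1) finT'] .
    also have "\<dots> \<le> n * rect_edges K S T'" using cST(2) by simp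
    finally have "(card S * rect_edges K S T) ^ 3 \<le> (n * rect_edges K S T') ^ 3"
      by (rule power_mono) simp
    moreover have "card S ^ 2 \<le> n ^ 2" using cST by (intro power_mono) auto
    ultimately have "card S ^ 2 * (card S * rect_edges K S T) ^ 3
        \<le> n ^ 2 * (n * rect_edges K S T') ^ 3"
      by (intro mult_mono) auto
    then have "rect_edges K S T ^ 3 * card S ^ 5 \<le> rect_edges K S T' ^ 3 * n ^ 5"
      by (simp add: power_def algebra_simps numeral_eq_Suc)
    with T' show ?thesis by blast
  qed
  show ?thesis
  proof (cases "card A \<le> card B")
    case True
    from main[OF fin True le(2), of G] show ?thesis
      using True by (metis min_absorb1 order_refl)
  next
    case False
    then have "card B \<le> card A" by simp
    from main[OF fin(2,1) this le(1), of "G\<inverse>"] show ?thesis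
      unfolding rect_edges_converse using False by (metis min_absorb2 nat_le_linear order_refl)
  qed
qed

text \<open>Vertices are placed one at a time. Leaving \<open>v\<close> out of \<open>A\<close> cuts
  the edges \<open>X\<close> from \<open>v\<close> to \<open>A\<close>, and adding \<open>v\<close>
  to \<open>A\<close> cuts the other edges \<open>Y\<close> at \<open>v\<close>; the larger of the
  two sets is chosen.\<close>

lemma max_cut:
  assumes "finite V" "finite E" "\<forall>e\<in>E. card e = 2" "\<Union>E \<subseteq> V"
  shows "\<exists>A\<subseteq>V. card E \<le> 2 * card {e \<in> E. card (e \<inter> A) = 1}"
  using assms
proof (induction V arbitrary: E rule: finite_induct)
  case empty
  then have "E = {}" by (metis Sup_bot_conv(1) card.empty subset_empty zero_neq_numeral
        all_not_in_conv)
  then show ?case by simp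
next
  case (insert v V)
  define E' where "E' = {e \<in> E. v \<notin> e}"
  have "\<exists>A\<subseteq>V. card E' \<le> 2 * card {e \<in> E'. card (e \<inter> A) = 1}"
    by (rule insert.IH) (use insert.prems in \<open>auto simp: E'_def\<close>)
  then obtain A where A: "A \<subseteq> V" "card E' \<le> 2 * card {e \<in> E'. card (e \<inter> A) = 1}" by blast
  have finE: "finite E" by fact
  define X where "X = {e \<in> E. v \<in> e \<and> e \<inter> A \<noteq> {}}"
  define Y where "Y = {e \<in> E. v \<in> e \<and> e \<inter> A = {}}"
  have vA: "v \<notin> A" using A insert.hyps by blast
  have "E = E' \<union> X \<union> Y" by (auto simp: E'_def X_def Y_def)
  then have "card E \<le> card E' + card X + card Y"
    by (metis card_Un_le add_right_mono order_trans)
  let ?C = "{e \<in> E'. card (e \<inter> A) = 1}"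
  show ?case
  proof (cases "card Y \<le> card X")
    case True
    have "card (e \<inter> A) = 1" if "e \<in> X" for e
    proof -
      have "card e = 2" "v \<in> e" "e \<inter> A \<noteq> {}" using that insert.prems by (auto simp: X_def)
      then obtain w where "e = {v, w}" "w \<in> A" using vA by (auto simp: card_2_iff)
      then have "e \<inter> A = {w}" using vA by auto
      then show ?thesis by simp
    qed
    then have "?C \<union> X \<subseteq> {e \<in> E. card (e \<inter> A) = 1}" by (auto simp: E'_def X_def)
    then have "card (?C \<union> X) \<le> card {e \<in> E. card (e \<inter> A) = 1}"
      using finE by (intro card_mono) auto
    moreover have "card (?C \<union> X) = card ?C + card X"
      using finE by (intro card_Un_disjoint) (auto simp: X_def E'_def)
    ultimately have "card E \<le> 2 * card {e \<in> E. card (e \<inter> A) = 1}"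
      using True A(2) \<open>card E \<le> card E' + card X + card Y\<close> by linarith
    then show ?thesis using A(1) by blast
  next
    case False
    have "card (e \<inter> insert v A) = 1" if "e \<in> Y" for e
    proof -
      have "e \<inter> insert v A = {v}" using that by (auto simp: Y_def)
      then show ?thesis by simp
    qed
    moreover have "e \<inter> insert v A = e \<inter> A" if "e \<in> E'" for e using that by (auto simp: E'_def)
    ultimately have "?C \<union> Y \<subseteq> {e \<in> E. card (e \<inter> insert v A) = 1}" by (auto simp: E'_def Y_def)
    then have "card (?C \<union> Y) \<le> card {e \<in> E. card (e \<inter> insert v A) = 1}"
      using finE by (intro card_mono) auto
    moreover have "card (?C \<union> Y) = card ?C + card Y"
      using finE by (intro card_Un_disjoint) (auto simp: Y_def E'_def)
    ultimately have "card E \<le> 2 * card {e \<in> E. card (e \<inter> insert v A) = 1}"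
      using False A(2) \<open>card E \<le> card E' + card X + card Y\<close> by linarith
    then show ?thesis using A(1) by (meson insert_mono)
  qed
qed

section \<open>Interval colouring a union of perfect matchings\<close>

lemma interval_colourable_perfect_matchings:
  fixes f :: "nat \<Rightarrow> nat \<Rightarrow> nat"
  assumes disj: "U \<inter> W = {}" and fin: "finite U" and r: "0 < r"
    and bij: "\<And>i. i < r \<Longrightarrow> bij_betw (f i) U W"
    and inj: "\<And>i j u. i < r \<Longrightarrow> j < r \<Longrightarrow> u \<in> U \<Longrightarrow> f i u = f j u \<Longrightarrow> i = j"
  defines "H \<equiv> (\<lambda>(i, u). {u, f i u}) ` ({..<r} \<times> U)"
  shows "interval_colourable H \<and> card H = r * card U"
proof -
  have W: "f i u \<in> W" if "i < r" "u \<in> U" for i u using bij that by (auto simp: bij_betw_def)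
  have uniq: "i = j \<and> u = w" if "i < r" "u \<in> U" "j < r" "w \<in> U" "{u, f i u} = {w, f j w}" for i j u w
  proof -
    have "u \<noteq> f j w" using W[OF that(3,4)] that(2) disj by blast
    then have "u = w" "f i u = f j w" using that(5) by (auto simp: doubleton_eq_iff)
    then show ?thesis using inj that by blast
  qed
  have "inj_on (\<lambda>(i, u). {u, f i u}) ({..<r} \<times> U)"
    using uniq by (auto simp: inj_on_def)
  then have card: "card H = r * card U"
    unfolding H_def by (simp add: card_image card_cartesian_product)
  \<comment> \<open>The colour of an edge is the index of its matching, unique by
    \<open>uniq\<close>. Every vertex of \<open>U\<close> and \<open>W\<close> meets every matching
    and so sees exactly the colours below \<open>r\<close>.\<close>
  define c where "c e = (THE i. i < r \<and> (\<exists>u\<in>U. e = {u, f i u}))" for e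
  have c: "c {u, f i u} = i" if "i < r" "u \<in> U" for i u
    unfolding c_def using that uniq by (intro the_equality) blast+
  have HE: "\<exists>i u. i < r \<and> u \<in> U \<and> e = {u, f i u}" if "e \<in> H" for e
    using that by (auto simp: H_def)
  have HI: "{u, f i u} \<in> H" if "i < r" "u \<in> U" for i u
    using that by (auto simp: H_def intro!: image_eqI[of _ _ "(i, u)"])
  have proper: "c e \<noteq> c e'" if e: "e \<in> H" "e' \<in> H" "e \<noteq> e'" "e \<inter> e' \<noteq> {}" for e e'
  proof
    assume eq: "c e = c e'"
    obtain i u where i: "i < r" "u \<in> U" "e = {u, f i u}" using HE e by blast
    obtain j w where j: "j < r" "w \<in> U" "e' = {w, f j w}" using HE e by blast
    have "i = j" using eq c i j by simp
    have "u \<noteq> w" using i j \<open>i = j\<close> e(3) by auto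
    then have "f i u \<noteq> f j w"
      using bij[OF i(1)] i j \<open>i = j\<close> by (auto simp: bij_betw_def inj_on_def)
    moreover have "u \<noteq> f j w" "w \<noteq> f i u" using W disj i j by blast+
    ultimately show False using e(4) i j \<open>u \<noteq> w\<close> by auto
  qed
  have interval: "\<exists>a b. c ` {e \<in> H. v \<in> e} = {a..b}" for v
  proof (cases "v \<in> U \<union> W")
    case True
    have "i \<in> c ` {e \<in> H. v \<in> e}" if i: "i < r" for i
    proof -
      obtain u where u: "u \<in> U" "v \<in> {u, f i u}"
        using True bij[OF i] by (auto simp: bij_betw_def)
      then show ?thesis using c[OF i u(1)] HI[OF i u(1)] by (intro image_eqI) auto
    qed
    moreover have "c e < r" if "e \<in> H" for e using HE[OF that] c by auto
    ultimately have "c ` {e \<in> H. v \<in> e} = {..<r}" by auto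
    also have "\<dots> = {0..r - 1}" using r by auto
    finally show ?thesis by blast
  next
    case False
    then have "{e \<in> H. v \<in> e} = {}" using HE W by fastforce
    \<comment> \<open>A vertex without edges has the empty interval.\<close>
    then have "c ` {e \<in> H. v \<in> e} = {1..0}" by simp
    then show ?thesis by blast
  qed
  have "interval_colouring H c" unfolding interval_colouring_def using proper interval by blast
  then show ?thesis using card by (auto simp: interval_colourable_def)
qed

lemma interval_colourable_singleton: "interval_colourable {e}"
proof -
  have "\<exists>a b. (\<lambda>_. 0 :: nat) ` {e' \<in> {e}. v \<in> e'} = {a..b}" for v
  proof (cases "v \<in> e")
    case True
    then have "(\<lambda>_. 0 :: nat) ` {e' \<in> {e}. v \<in> e'} = {0..0}" by auto
    then show ?thesis by blast
  next
    case False
    then have "(\<lambda>_. 0 :: nat) ` {e' \<in> {e}. v \<in> e'} = {1..0}" by auto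
    then show ?thesis by blast
  qed
  then have "interval_colouring {e} (\<lambda>_. 0)" unfolding interval_colouring_def by blast
  then show ?thesis unfolding interval_colourable_def by blast
qed

text \<open>A cut with at least \<open>m / 2\<close> edges contains an extremal pair of size
  \<open>N\<close> with \<open>e\<close> edges. For \<open>x = m^3 / (8 n^5)\<close>, maximality
  gives \<open>x * N^5 \<le> e^3\<close>, and \<open>e \<le> N^2\<close> then gives
  \<open>x \<le> N\<close>, hence \<open>x^2 \<le> e\<close>. If \<open>e \<ge> 100 N\<close>,
  matchings cover at least \<open>e / 200\<close> edges; otherwise \<open>x \<le> 100\<close> and a
  single edge suffices. The constant is \<open>64 * 100^2\<close>, from the second case.\<close>

lemma large_interval_colourable_subgraph:
  assumes E: "simple_graph E" "E \<noteq> {}" and n: "card (\<Union>E) \<le> n"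
  shows "\<exists>H\<subseteq>E. H \<noteq> {} \<and> interval_colourable H \<and>
           real (card E) ^ 6 \<le> 640000 * real n ^ 10 * card H"
proof -
  define V where "V = \<Union>E"
  define m where "m = card E"
  have finE: "finite E" and c2: "\<forall>e\<in>E. card e = 2" using E(1) by (auto simp: simple_graph_def)
  have finV: "finite V" unfolding V_def using finE c2
    by (metis card.infinite finite_Union zero_neq_numeral)
  have mpos: "m > 0" using E finE by (auto simp: m_def card_gt_0_iff)
  obtain A where A: "A \<subseteq> V" "m \<le> 2 * card {e \<in> E. card (e \<inter> A) = 1}"
    using max_cut[OF finV finE c2] by (auto simp: V_def m_def)
  define B where "B = V - A"
  define G where "G = {(u, w). {u, w} \<in> E \<and> u \<in> A \<and> w \<in> B}"
  have GAB: "G \<subseteq> A \<times> B" by (auto simp: G_def)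
  have fin: "finite A" "finite B" using A finV finite_subset by (auto simp: B_def)
  have finG: "finite G" using GAB fin finite_subset by blast
  have "{e \<in> E. card (e \<inter> A) = 1} \<subseteq> (\<lambda>(u, w). {u, w}) ` G"
  proof
    fix e assume e: "e \<in> {e \<in> E. card (e \<inter> A) = 1}"
    then obtain u where u: "e \<inter> A = {u}" by (auto simp: card_1_singleton_iff)
    obtain x y where xy: "e = {x, y}" "x \<noteq> y" using e c2 by (auto simp: card_2_iff)
    have "u = x \<or> u = y" using u xy by auto
    then obtain w where w: "e = {u, w}" "u \<noteq> w" using xy by (metis insert_commute)
    have "w \<in> V" using e w by (auto simp: V_def)
    moreover have "w \<notin> A" "u \<in> A" using u w by auto
    ultimately have "(u, w) \<in> G" using e w by (auto simp: G_def B_def)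
    then show "e \<in> (\<lambda>(u, w). {u, w}) ` G" using w by (intro image_eqI[of _ _ "(u, w)"]) auto
  qed
  then have "card {e \<in> E. card (e \<inter> A) = 1} \<le> card G" using finG surj_card_le by blast
  then have mG: "m \<le> 2 * card G" using A by linarith
  then have "G \<noteq> {}" using mpos by auto
  then have ne: "A \<noteq> {}" "B \<noteq> {}" using GAB by auto
  have nAB: "card A \<le> n" "card B \<le> n"
    using n A card_mono[OF finV, of A] card_mono[OF finV, of B] by (auto simp: B_def V_def)
  have npos: "n > 0" using nAB ne fin by (metis card_gt_0_iff less_le_trans)
  obtain U0 W0 where 0: "U0 \<subseteq> A" "W0 \<subseteq> B" "card U0 = card W0"
      "card U0 = min (card A) (card B)"
      "rect_edges G A B ^ 3 * card U0 ^ 5 \<le> rect_edges G U0 W0 ^ 3 * n ^ 5"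
    using balanced_pair_exists[OF fin nAB, of G] by (elim exE conjE)
  have "card U0 > 0" using 0(4) ne fin by (simp add: card_gt_0_iff)
  obtain U W where UW: "U \<subseteq> A" "W \<subseteq> B" "U \<noteq> {}" "extremal_pair G U W"
    and max: "\<forall>S T. S \<subseteq> A \<and> T \<subseteq> B \<and> card S = card T \<longrightarrow>
        rect_edges G S T ^ 3 * card U ^ 5 \<le> rect_edges G U W ^ 3 * card S ^ 5"
    using extremal_pair_exists[OF fin ne, of G] by (elim exE conjE)
  have finU: "finite U" "finite W" "card U = card W" using UW by (auto simp: extremal_pair_def)
  define N where "N = card U"
  define e where "e = rect_edges G U W"
  have Npos: "N > 0" unfolding N_def card_gt_0_iff using finU UW by blast
  have eN: "e \<le> N * N" using rect_edges_le[OF finU(1,2), of G] finU by (simp add: e_def N_def)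
  have AB: "rect_edges G A B = card G" using GAB by (simp add: rect_edges_def Int_absorb2)
  \<comment> \<open>The balanced pair \<open>U0\<close>, \<open>W0\<close> links the density of the
    whole cut to that of the extremal pair; its size cancels at the end.\<close>
  have "card U0 ^ 5 * (card G ^ 3 * N ^ 5) = (card G ^ 3 * card U0 ^ 5) * N ^ 5" by simp
  also have "\<dots> \<le> (rect_edges G U0 W0 ^ 3 * n ^ 5) * N ^ 5"
    using 0(5) AB by (intro mult_right_mono) auto
  also have "\<dots> = (rect_edges G U0 W0 ^ 3 * N ^ 5) * n ^ 5" by simp
  also have "\<dots> \<le> (e ^ 3 * card U0 ^ 5) * n ^ 5"
    using max[rule_format, OF conjI[OF 0(1) conjI[OF 0(2,3)]]] by (intro mult_right_mono) (auto simp: e_def N_def)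
  also have "\<dots> = card U0 ^ 5 * (e ^ 3 * n ^ 5)" by simp
  finally have "card G ^ 3 * N ^ 5 \<le> e ^ 3 * n ^ 5" using \<open>card U0 > 0\<close> by simp
  then have "8 * (card G ^ 3 * N ^ 5) \<le> 8 * (e ^ 3 * n ^ 5)" by simp
  moreover have "m ^ 3 * N ^ 5 \<le> (2 * card G) ^ 3 * N ^ 5"
    using mG by (intro mult_right_mono power_mono) auto
  moreover have "(2 * card G) ^ 3 * N ^ 5 = 8 * (card G ^ 3 * N ^ 5)"
    by (simp add: power_mult_distrib)
  ultimately have "m ^ 3 * N ^ 5 \<le> 8 * (e ^ 3 * n ^ 5)" by linarith
  then have "real (m ^ 3 * N ^ 5) \<le> real (8 * (e ^ 3 * n ^ 5))" by (rule of_nat_mono)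
  then have key: "real m ^ 3 * real N ^ 5 \<le> 8 * (real e ^ 3 * real n ^ 5)" by simp
  define x where "x = real m ^ 3 / (8 * real n ^ 5)"
  have x0: "x \<ge> 0" by (simp add: x_def)
  have xe: "x * real N ^ 5 \<le> real e ^ 3"
    using key npos by (simp add: x_def field_simps)
  have mx: "real m ^ 6 = 64 * real n ^ 10 * x ^ 2"
    using npos by (simp add: x_def power_divide power_mult_distrib flip: power_mult)
  have "real e ^ 3 \<le> (real N * real N) ^ 3"
    using eN by (intro power_mono) (auto simp flip: of_nat_mult)
  then have "x * real N ^ 5 \<le> real N * real N ^ 5"
    using xe by (simp add: power_def numeral_eq_Suc algebra_simps)
  then have xN: "x \<le> real N" using Npos by simp
  show ?thesis
  proof (cases "100 * N \<le> e")
    case True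
    \<comment> \<open>Rounding down costs at most a factor 2 because the quotient is at least 1;
      hence the 200 in \<open>e200\<close>.\<close>
    define r where "r = e div (100 * N)"
    have r: "0 < r" "100 * r * N \<le> e"
      using True Npos by (auto simp: r_def div_greater_zero_iff)
         (metis div_times_less_eq_dividend mult.assoc mult.commute)
    have "e < 100 * N * (r + 1)"
      using Npos unfolding r_def by (metis dividend_less_times_div mult_pos_pos zero_less_numeral
          distrib_left mult.right_neutral add.commute)
    also have "\<dots> \<le> 100 * N * (2 * r)" using r by (intro mult_left_mono) auto
    finally have e200: "e \<le> 200 * (r * N)" by (simp add: algebra_simps)
    have "\<exists>f. (\<forall>i<r. bij_betw (f i) U W \<and> (\<forall>u\<in>U. (u, f i u) \<in> G)) \<and>
             (\<forall>i<r. \<forall>j<r. \<forall>u\<in>U. f i u = f j u \<longrightarrow> i = (j::nat))"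
      using finU extremal_pair_dense[OF UW(4)] r(2) unfolding e_def N_def rect_edges_def
      by (intro disjoint_perfect_matchings) auto
    then obtain f where f: "\<And>i. i < r \<Longrightarrow> bij_betw (f i) U W"
        "\<And>i u. i < r \<Longrightarrow> u \<in> U \<Longrightarrow> (u, f i u) \<in> G"
        "\<And>i j u. i < r \<Longrightarrow> j < r \<Longrightarrow> u \<in> U \<Longrightarrow> f i u = f j u \<Longrightarrow> i = j"
      by blast
    define H where "H = (\<lambda>(i, u). {u, f i u}) ` ({..<r} \<times> U)"
    have disj: "U \<inter> W = {}" using UW by (auto simp: B_def)
    have H: "interval_colourable H" "card H = r * N"
      using interval_colourable_perfect_matchings[OF disj finU(1) r(1) f(1,3)]
      by (auto simp: H_def N_def)
    have HE: "H \<subseteq> E" using f(2) by (auto simp: H_def G_def)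
    have "(x ^ 2) ^ 3 = x * x ^ 5" by (simp add: power_def numeral_eq_Suc)
    also have "\<dots> \<le> x * real N ^ 5" using x0 xN by (intro mult_left_mono power_mono) auto
    also note xe
    finally have "x ^ 2 \<le> real e" using x0 by (subst (asm) power_mono_iff) auto
    also have "\<dots> \<le> real (200 * (r * N))" using e200 by (rule of_nat_mono)
    finally have "x ^ 2 \<le> 200 * real (card H)" using H by simp
    then have "real m ^ 6 \<le> 64 * real n ^ 10 * (200 * real (card H))"
      unfolding mx by (intro mult_left_mono) auto
    also have "\<dots> \<le> 640000 * real n ^ 10 * card H" by simp
    finally have "real m ^ 6 \<le> 640000 * real n ^ 10 * card H" .
    moreover have "card H > 0" using H r Npos by simp
    then have "H \<noteq> {}" by auto
    ultimately show ?thesis using H HE by (auto simp: m_def)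
  next
    case False
    \<comment> \<open>With fewer than \<open>100 N\<close> edges,
      \<open>x * N^2 \<le> 100^3\<close>, and \<open>x \<le> N\<close> turns this into
      \<open>x \<le> 100\<close>. The required size of \<open>H\<close> is then at most 1.\<close>
    have "x * real N ^ 5 \<le> real e ^ 3" by fact
    also have "\<dots> \<le> (100 * real N) ^ 3" using False by (intro power_mono) auto
    finally have "(x * real N ^ 2) * real N ^ 3 \<le> 100 ^ 3 * real N ^ 3"
      by (simp add: power_def numeral_eq_Suc algebra_simps)
    then have "x * real N ^ 2 \<le> 100 ^ 3" using Npos by simp
    moreover have "x * x ^ 2 \<le> x * real N ^ 2" using x0 xN by (intro mult_left_mono power_mono) auto
    ultimately have "x ^ 3 \<le> 100 ^ 3" by (simp add: power3_eq_cube power2_eq_square)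
    then have "x \<le> 100" using x0 by (subst (asm) power_mono_iff) auto
    then have "x ^ 2 \<le> 100 ^ 2" using x0 by (intro power_mono) auto
    then have "64 * real n ^ 10 * x ^ 2 \<le> 64 * real n ^ 10 * 100 ^ 2" by (intro mult_left_mono) auto
    then have "real m ^ 6 \<le> 640000 * real n ^ 10" unfolding mx by simp
    moreover obtain a where "a \<in> E" using E by blast
    ultimately show ?thesis
      using interval_colourable_singleton[of a] by (intro exI[of _ "{a}"]) (auto simp: m_def)
  qed
qed

section \<open>Decompositions into interval colourable graphs\<close>

text \<open>The property minimised in \<open>ic_thickness\<close>, isolated so that decompositions
  can be put together. Classes may be empty.\<close>

definition ic_splits :: "nat set set \<Rightarrow> nat \<Rightarrow> bool" where
  "ic_splits E k \<longleftrightarrow> (\<exists>p :: nat set \<Rightarrow> nat. p ` E \<subseteq> {..<k} \<and>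
       (\<forall>i<k. interval_colourable {e\<in>E. p e = i}))"

lemma ic_thickness_le: "ic_splits E k \<Longrightarrow> ic_thickness E \<le> k"
  unfolding ic_splits_def ic_thickness_def by (rule Least_le)

lemma ic_splits_empty: "ic_splits {} 0"
  by (simp add: ic_splits_def)

lemma ic_splits_one:
  assumes "interval_colourable E"
  shows "ic_splits E 1"
  unfolding ic_splits_def by (rule exI[of _ "\<lambda>_. 0"]) (use assms in auto)

lemma ic_splits_Un:
  assumes "ic_splits E a" "ic_splits F b" "E \<inter> F = {}"
  shows "ic_splits (E \<union> F) (a + b)"
proof -
  obtain p q where p: "p ` E \<subseteq> {..<a}" "\<forall>i<a. interval_colourable {e\<in>E. p e = i}"
    and q: "q ` F \<subseteq> {..<b}" "\<forall>i<b. interval_colourable {e\<in>F. q e = i}"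
    using assms(1,2) unfolding ic_splits_def by (elim exE conjE)
  define s where "s e = (if e \<in> E then p e else a + q e)" for e
  have "interval_colourable {e \<in> E \<union> F. s e = i}" if "i < a + b" for i
  proof (cases "i < a")
    case True
    then have "{e \<in> E \<union> F. s e = i} = {e\<in>E. p e = i}" by (auto simp: s_def)
    then show ?thesis using p True by simp
  next
    case False
    then have "{e \<in> E \<union> F. s e = i} = {e\<in>F. q e = i - a}"
      using p(1) assms(3) by (auto simp: s_def)
    then show ?thesis using q False that by simp
  qed
  moreover have "s ` (E \<union> F) \<subseteq> {..<a + b}" using p(1) q(1) by (auto simp: s_def)
  ultimately show ?thesis unfolding ic_splits_def by blast
qed

section \<open>Peeling off vertices of small degree\<close>

lemma interval_colourable_pendant:
  assumes "interval_colourable E" "v \<notin> \<Union>E" "u \<noteq> v"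
  shows "interval_colourable (insert {u, v} E)"
proof -
  obtain c where "interval_colouring E c" using assms(1) unfolding interval_colourable_def ..
  then have c: "\<And>e e'. e \<in> E \<Longrightarrow> e' \<in> E \<Longrightarrow> e \<noteq> e' \<Longrightarrow> e \<inter> e' \<noteq> {} \<Longrightarrow> c e \<noteq> c e'"
      "\<And>w. \<exists>a b. c ` {e\<in>E. w \<in> e} = {a..b}"
    unfolding interval_colouring_def by simp_all
  have new: "{u, v} \<notin> E" using assms(2) by auto
  obtain a b where ab: "c ` {e\<in>E. u \<in> e} = {a..b}" using c(2) by blast
  \<comment> \<open>The new edge prolongs the interval at \<open>u\<close> by one colour; at
    \<open>v\<close> it is the only edge. If \<open>u\<close> had no edge, \<open>{a..b}\<close> is
    empty and the edge may start an interval anywhere, here at 0.\<close>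
  define x where "x = (if a \<le> b then b + 1 else 0)"
  define d where "d = c({u, v} := x)"
  have dE: "d e = c e" if "e \<in> E" for e using that new by (auto simp: d_def)
  have dx: "c e \<noteq> x" if "e \<in> E" "u \<in> e" for e
  proof -
    have "c e \<in> {a..b}" using that ab by blast
    then show ?thesis by (auto simp: x_def)
  qed
  have proper: "d e \<noteq> d e'" if "e \<in> insert {u, v} E" "e' \<in> insert {u, v} E" "e \<noteq> e'" "e \<inter> e' \<noteq> {}" for e e'
  proof -
    have *: "c f \<noteq> x" if "f \<in> E" "{u, v} \<inter> f \<noteq> {}" for f
      using that assms(2) dx[of f] by auto
    show ?thesis
    proof (cases "e = {u, v}")
      case True
      then have "e' \<in> E" using that by auto
      then show ?thesis using *[of e'] that True dE[of e'] by (auto simp: d_def)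
    next
      case False
      then have "e \<in> E" using that by auto
      show ?thesis
      proof (cases "e' = {u, v}")
        case True
        then show ?thesis using *[of e] that \<open>e \<in> E\<close> dE[of e] by (auto simp: d_def)
      next
        case False
        then show ?thesis using c(1)[of e e'] that \<open>e \<in> E\<close> dE by auto
      qed
    qed
  qed
  have interval: "\<exists>a b. d ` {e \<in> insert {u, v} E. w \<in> e} = {a..b}" for w
  proof -
    consider "w = u" | "w = v" | "w \<noteq> u" "w \<noteq> v" by blast
    then show ?thesis
    proof cases
      case 1
      have "{e \<in> insert {u, v} E. w \<in> e} = insert {u, v} {e \<in> E. u \<in> e}" using 1 by auto
      then have "d ` {e \<in> insert {u, v} E. w \<in> e} = insert (d {u, v}) (d ` {e \<in> E. u \<in> e})"
        by (simp only: image_insert)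
      also have "d {u, v} = x" by (simp add: d_def)
      also have "d ` {e \<in> E. u \<in> e} = {a..b}" using ab dE by (auto simp: image_iff)
      also have "insert x {a..b} = (if a \<le> b then {a..b + 1} else {0..0})" by (auto simp: x_def)
      finally show ?thesis by (metis (full_types))
    next
      case 2
      then have "{e \<in> insert {u, v} E. w \<in> e} = {{u, v}}" using assms by auto
      then have "d ` {e \<in> insert {u, v} E. w \<in> e} = {x..x}" by (simp add: d_def)
      then show ?thesis by blast
    next
      case 3
      then have "{e \<in> insert {u, v} E. w \<in> e} = {e \<in> E. w \<in> e}" by auto
      then have "d ` {e \<in> insert {u, v} E. w \<in> e} = c ` {e \<in> E. w \<in> e}"
        using dE by (auto simp: image_iff)
      then show ?thesis using c(2) by simp
    qed
  qed
  have "interval_colouring (insert {u, v} E) d"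
    unfolding interval_colouring_def using proper interval by blast
  then show ?thesis unfolding interval_colourable_def by blast
qed

text \<open>As long as some vertex \<open>v\<close> has degree at most \<open>D\<close>, remove its
  edges, split the rest, and give the removed edges to distinct classes. No class of the rest
  contains \<open>v\<close>, so each class gains at most one pendant edge and stays interval
  colourable.\<close>

lemma core_decomposition:
  assumes "finite E" "\<forall>e\<in>E. card e = 2"
  shows "\<exists>F\<subseteq>E. (\<forall>v\<in>\<Union>F. D < card {e\<in>F. v \<in> e}) \<and> ic_splits (E - F) D"
  using assms
proof (induction E rule: finite_psubset_induct)
  case (psubset E)
  show ?case
  proof (cases "\<forall>v\<in>\<Union>E. D < card {e\<in>E. v \<in> e}")
    case True
    have "interval_colourable {}"
      unfolding interval_colourable_def interval_colouring_def by (auto intro: exI[of _ 1] exI[of _ 0])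
    then have "ic_splits (E - E) D" by (simp add: ic_splits_def)
    then show ?thesis using True by blast
  next
    case False
    then obtain v where v: "v \<in> \<Union>E" "card {e\<in>E. v \<in> e} \<le> D" by (auto simp: not_less)
    define St where "St = {e\<in>E. v \<in> e}"
    have finSt: "finite St" using psubset.hyps by (simp add: St_def)
    have "E - St \<subset> E" using v by (auto simp: St_def)
    then have "\<exists>F\<subseteq>E - St. (\<forall>v\<in>\<Union>F. D < card {e\<in>F. v \<in> e}) \<and> ic_splits (E - St - F) D"
      using psubset.prems by (intro psubset.IH) auto
    then obtain F where F: "F \<subseteq> E - St" "\<forall>v\<in>\<Union>F. D < card {e\<in>F. v \<in> e}"
      and "ic_splits (E - St - F) D" by (elim exE conjE)
    then obtain p where p: "p ` (E - St - F) \<subseteq> {..<D}" "\<forall>i<D. interval_colourable {e \<in> E - St - F. p e = i}"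
      unfolding ic_splits_def by (elim exE conjE)
    \<comment> \<open>A numbering of the at most \<open>D\<close> edges at \<open>v\<close> serves
      as the injective choice of classes.\<close>
    obtain h where h: "bij_betw h St {0..<card St}" using ex_bij_betw_finite_nat[OF finSt] by blast
    have hD: "h e < D" if "e \<in> St" for e
    proof -
      have "h e \<in> {0..<card St}" using h that by (auto simp: bij_betw_def)
      then show ?thesis using v(2) by (simp add: St_def)
    qed
    define q where "q e = (if v \<in> e then h e else p e)" for e
    have "q e < D" if "e \<in> E - F" for e
    proof (cases "v \<in> e")
      case True
      then show ?thesis using hD that by (simp add: q_def St_def)
    next
      case False
      then have "e \<in> E - St - F" using that by (simp add: St_def)
      then show ?thesis using p(1) False by (auto simp: q_def)
    qed
    moreover have "interval_colourable {e \<in> E - F. q e = i}" if "i < D" for i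
    proof -
      let ?C = "{e \<in> E - St - F. p e = i}"
      have C: "interval_colourable ?C" using p(2) that by blast
      have eq: "{e \<in> E - F. q e = i} = {e \<in> St. h e = i} \<union> ?C"
        using F(1) by (auto simp: q_def St_def)
      show ?thesis
      proof (cases "\<exists>e\<in>St. h e = i")
        case True
        then obtain e where e: "e \<in> St" "h e = i" by blast
        then have "{e \<in> St. h e = i} = {e}" using h by (auto simp: bij_betw_def inj_on_def)
        moreover obtain u where "e = {u, v}" "u \<noteq> v"
        proof -
          have "card e = 2" "v \<in> e" using e psubset.prems by (auto simp: St_def)
          then show ?thesis using that by (auto simp: card_2_iff)
        qed
        ultimately have "{e \<in> E - F. q e = i} = insert {u, v} ?C" using eq by simp
        moreover have "v \<notin> \<Union>?C" by (auto simp: St_def)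
        ultimately show ?thesis using interval_colourable_pendant[OF C _ \<open>u \<noteq> v\<close>] by simp
      next
        case False
        then have "{e \<in> E - F. q e = i} = ?C" using eq by blast
        then show ?thesis using C by simp
      qed
    qed
    ultimately have "ic_splits (E - F) D" unfolding ic_splits_def by blast
    then show ?thesis using F by blast
  qed
qed

text \<open>Double counting of incidences, used to bound the number of vertices of a core.\<close>

lemma min_degree_vertex_bound:
  assumes "finite F" "\<forall>e\<in>F. card e = 2" "\<forall>v\<in>\<Union>F. D < card {e\<in>F. v \<in> e}"
  shows "card (\<Union>F) * D \<le> 2 * card F"
proof -
  have finV: "finite (\<Union>F)" using assms by (metis card.infinite finite_Union zero_neq_numeral)
  have "card (\<Union>F) * D = (\<Sum>v\<in>\<Union>F. D)" by simp
  also have "\<dots> \<le> (\<Sum>v\<in>\<Union>F. card {e\<in>F. v \<in> e})"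
    using assms(3) by (intro sum_mono) (meson less_imp_le)
  also have "\<dots> = (\<Sum>e\<in>F. 2)"
  proof (rule sum_multicount_gen[OF finV assms(1)])
    have "{v \<in> \<Union>F. v \<in> e} = e" if "e \<in> F" for e using that by auto
    then show "\<forall>e\<in>F. card {v \<in> \<Union>F. v \<in> e} = 2" using assms(2) by simp
  qed
  finally show ?thesis by simp
qed

text \<open>A discrete form of the fact that \<open>1 / x^5\<close> has derivative
  \<open>- 5 / x^6\<close>, whose absolute value on the interval is least at \<open>a\<close>. It
  follows from Bernoulli's inequality for \<open>(a / b)^5\<close>.\<close>

lemma inverse_power5_diff:
  fixes a b :: real
  assumes "0 < b" "b \<le> a"
  shows "5 * (a - b) / a ^ 6 \<le> 1 / b ^ 5 - 1 / a ^ 5"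
proof -
  have a: "a > 0" using assms by simp
  have "(a - b) / a \<le> (a - b) / b" using assms by (intro divide_left_mono) auto
  then have "1 + 5 * ((a - b) / a) \<le> 1 + 5 * ((a - b) / b)" by linarith
  also have "\<dots> \<le> (1 + (a - b) / b) ^ 5"
  proof -
    have "0 \<le> (a - b) / b" using assms by simp
    then have "-1 \<le> (a - b) / b" by linarith
    from Bernoulli_inequality[OF this, of 5] show ?thesis by simp
  qed
  also have "1 + (a - b) / b = a / b" using assms by (simp add: field_simps)
  finally have "(1 + 5 * ((a - b) / a)) / a ^ 5 \<le> (a / b) ^ 5 / a ^ 5"
    using a by (intro divide_right_mono) auto
  also have "\<dots> = 1 / b ^ 5" using a by (simp add: power_divide)
  also have "(1 + 5 * ((a - b) / a)) / a ^ 5 = 1 / a ^ 5 + 5 * (a - b) / a ^ 6"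
    using a by (simp add: add_divide_distrib power_def numeral_eq_Suc)
  finally show ?thesis by simp
qed

text \<open>Removing an interval colourable subgraph with at least \<open>m^6 / (640000 n^10)\<close> of the \<open>m\<close>
  edges lowers the potential \<open>- n^10 / m^5\<close> by a constant.\<close>

lemma sparse_remainder:
  fixes M :: real
  assumes M: "M > 0" and E: "simple_graph E" "card (\<Union>E) \<le> n"
  shows "\<exists>F\<subseteq>E. \<exists>k. card F \<le> M \<and> ic_splits (E - F) k \<and> real k \<le> 1 + 128000 * real n ^ 10 / M ^ 5"
proof -
  \<comment> \<open>The factor is \<open>640000 / 5\<close>, the 5 coming from
    \<open>inverse_power5_diff\<close>. The summand 1 pays for the last removal, which may take the
    number of edges far below \<open>M\<close>.\<close>
  define g where "g m = 1 + 128000 * real n ^ 10 * (1 / M ^ 5 - 1 / real m ^ 5)" for m :: nat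
  have "finite E" "\<forall>e\<in>E. card e = 2" using E by (auto simp: simple_graph_def)
  then have "\<exists>F\<subseteq>E. \<exists>k. card F \<le> M \<and> ic_splits (E - F) k \<and>
      (card E \<le> M \<and> k = 0 \<or> M < card E \<and> real k \<le> g (card E))"
    using E(2)
  proof (induction E rule: finite_psubset_induct)
    case (psubset E)
    define m where "m = card E"
    show ?case
    proof (cases "real m \<le> M")
      case True
      then show ?thesis using ic_splits_empty by (intro exI[of _ E]) (auto simp: m_def)
    next
      case False
      then have mM: "M < m" by simp
      then have "E \<noteq> {}" using M by (auto simp: m_def)
      have "simple_graph E" using psubset by (simp add: simple_graph_def)
      then obtain H where H: "H \<subseteq> E" "H \<noteq> {}" "interval_colourable H"
        "real m ^ 6 \<le> 640000 * real n ^ 10 * card H"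
        using large_interval_colourable_subgraph[OF _ \<open>E \<noteq> {}\<close> psubset.prems(2)]
        unfolding m_def by blast
      have finH: "finite H" using H psubset.hyps finite_subset by blast
      have finV: "finite (\<Union>E)"
        using psubset by (metis card.infinite finite_Union zero_neq_numeral)
      have "card (\<Union>(E - H)) \<le> card (\<Union>E)" using finV by (intro card_mono) auto
      then have "card (\<Union>(E - H)) \<le> n" using psubset.prems by linarith
      moreover have "E - H \<subset> E" using H by blast
      ultimately obtain F k where F: "F \<subseteq> E - H" "card F \<le> M" "ic_splits (E - H - F) k"
        "card (E - H) \<le> M \<and> k = 0 \<or> M < card (E - H) \<and> real k \<le> g (card (E - H))"
        using psubset.IH[of "E - H"] psubset.prems by auto
      have "ic_splits (H \<union> (E - H - F)) (1 + k)"
        by (intro ic_splits_Un ic_splits_one H F) auto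
      moreover have "H \<union> (E - H - F) = E - F" using H F by auto
      ultimately have split: "ic_splits (E - F) (1 + k)" by simp
      define m' where "m' = card (E - H)"
      have mm': "m = m' + card H"
        unfolding m_def m'_def using H finH card_mono[OF psubset.hyps H(1)] by (simp add: card_Diff_subset)
      have "real (1 + k) \<le> g m"
      proof (cases "real m' \<le> M \<and> k = 0")
        case True
        have "1 / real m ^ 5 \<le> 1 / M ^ 5"
          using M mM by (intro divide_left_mono power_mono) auto
        then show ?thesis using True by (simp add: g_def)
      next
        case False
        then have k: "real k \<le> g m'" "M < m'" using F(4) by (auto simp: m'_def)
        have "5 * (real m - real m') / real m ^ 6 \<le> 1 / real m' ^ 5 - 1 / real m ^ 5"
          using k M mm' by (intro inverse_power5_diff) auto
        then have "128000 * real n ^ 10 * (5 * (real m - real m') / real m ^ 6)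
            \<le> 128000 * real n ^ 10 * (1 / real m' ^ 5 - 1 / real m ^ 5)"
          by (rule mult_left_mono) simp
        moreover have "1 \<le> 128000 * real n ^ 10 * (5 * (real m - real m') / real m ^ 6)"
          using H(4) M mM mm' by (simp add: field_simps)
        ultimately have "g m' + 1 \<le> g m" unfolding g_def by (simp add: algebra_simps)
        then show ?thesis using k by simp
      qed
      then show ?thesis using F(1,2) split by (intro exI[of _ F]) (use mM in \<open>auto simp: m_def\<close>)
    qed
  qed
  then obtain F k where F: "F \<subseteq> E" "card F \<le> M" "ic_splits (E - F) k"
      "card E \<le> M \<and> k = 0 \<or> M < card E \<and> real k \<le> g (card E)" by blast
  have "g (card E) \<le> 1 + 128000 * real n ^ 10 / M ^ 5"
    unfolding g_def by (simp add: algebra_simps)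
  moreover have "0 \<le> 1 + 128000 * real n ^ 10 / M ^ 5" using M by simp
  ultimately have "real k \<le> 1 + 128000 * real n ^ 10 / M ^ 5" using F(4) by auto
  then show ?thesis using F by blast
qed

section \<open>The bounds\<close>

lemma ic_splits_vertex_bound:
  assumes "simple_graph E" "card (\<Union>E) \<le> n"
  shows "\<exists>k. ic_splits E k \<and> real k \<le> 320015 * real n powr (5/6)"
  using assms
proof (induction n arbitrary: E rule: less_induct)
  case (less n)
  have finE: "finite E" and c2: "\<forall>e\<in>E. card e = 2"
    using less.prems by (auto simp: simple_graph_def)
  have finV: "finite (\<Union>E)" using finE c2 by (metis card.infinite finite_Union zero_neq_numeral)
  show ?case
  proof (cases "n = 0")
    \<comment> \<open>Here \<open>0 powr (5/6)\<close> is 0, so the empty graph has to be split into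
      no classes at all.\<close>
    case True
    then have "\<Union>E = {}" using less.prems finV by simp
    then have "E = {}" using c2 by fastforce
    then show ?thesis using ic_splits_empty by (intro exI[of _ 0]) auto
  next
    case False
    define t where "t = real n powr (5/6)"
    have t1: "t \<ge> 1" unfolding t_def using False by (intro ge_one_powr_ge_zero) auto
    \<comment> \<open>This threshold balances the two costs: the number \<open>n^10 / M^5\<close> of
      removals and the average degree scale \<open>M / n\<close> of the remainder both equal
      \<open>t\<close>.\<close>
    define M where "M = real n powr (11/6)"
    have Mt: "M = real n * t"
      unfolding M_def t_def using False by (simp add: powr_mult_base)
    have M0: "M > 0" using False by (simp add: M_def)
    have t6: "t ^ 6 = real n ^ 5"
      unfolding t_def using False by (simp add: powr_realpow[symmetric] powr_powr flip: powr_numeral)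
    have "M ^ 5 * t = real n ^ 5 * t ^ 6"
      unfolding Mt by (simp add: power_mult_distrib power_def numeral_eq_Suc)
    also have "\<dots> = real n ^ 10" unfolding t6 by (simp flip: power_add)
    finally have nM: "real n ^ 10 / M ^ 5 = t" using M0 by (simp add: field_simps)
    obtain F k1 where F: "F \<subseteq> E" "card F \<le> M" "ic_splits (E - F) k1"
        "real k1 \<le> 1 + 128000 * real n ^ 10 / M ^ 5"
      using sparse_remainder[OF M0 less.prems] by (elim exE conjE)
    have "128000 * real n ^ 10 / M ^ 5 = 128000 * (real n ^ 10 / M ^ 5)" by simp
    then have k1: "real k1 \<le> 1 + 128000 * t" using F(4) nM by simp
    have finF: "finite F" "\<forall>e\<in>F. card e = 2" using F finE c2 finite_subset by auto
    \<comment> \<open>At most \<open>M = n * t\<close> edges are left, so a core of minimum degree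
      above \<open>4 * t\<close> has at most \<open>2 * M / (4 * t) = n / 2\<close>
      vertices.\<close>
    define D where "D = nat \<lceil>4 * t\<rceil>"
    have D: "4 * t \<le> D" "D \<le> 4 * t + 1" using t1 unfolding D_def by linarith+
    obtain F' where F': "F' \<subseteq> F" "\<forall>v\<in>\<Union>F'. D < card {e\<in>F'. v \<in> e}" "ic_splits (F - F') D"
      using core_decomposition[OF finF, of D] by (elim exE conjE)
    have finF': "finite F'" "\<forall>e\<in>F'. card e = 2" using F' finF finite_subset by auto
    have "card (\<Union>F') * D \<le> 2 * card F'" by (rule min_degree_vertex_bound[OF finF' F'(2)])
    also have "\<dots> \<le> 2 * card F" using card_mono[OF finF(1) F'(1)] by simp
    finally have "real (card (\<Union>F') * D) \<le> real (2 * card F)" by (rule of_nat_mono)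
    then have "real (card (\<Union>F')) * D \<le> 2 * M" using F(2) by simp
    moreover have "real (card (\<Union>F')) * (4 * t) \<le> real (card (\<Union>F')) * D"
      using D by (intro mult_left_mono) auto
    ultimately have "(2 * real (card (\<Union>F'))) * t \<le> real n * t" unfolding Mt by linarith
    then have "2 * real (card (\<Union>F')) \<le> real n" using t1 by simp
    then have half: "card (\<Union>F') \<le> n div 2" by linarith
    have "simple_graph F'" using finF' by (simp add: simple_graph_def)
    then obtain k where k: "ic_splits F' k" "real k \<le> 320015 * real (n div 2) powr (5/6)"
      using less.IH[of "n div 2" F'] half False by auto
    have "real (n div 2) powr (5/6) \<le> (real n / 2) powr (5/6)"
      by (intro powr_mono2) (auto simp: field_simps)
    also have "\<dots> = t / 2 powr (5/6)" unfolding t_def by (simp add: powr_divide)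
    also have "\<dots> \<le> t * (3/5)"
    proof -
      have "(5/3 :: real) ^ 6 \<le> 2 ^ 5" by (simp add: power_def numeral_eq_Suc)
      also have "(2::real) ^ 5 = (2 powr (5/6)) ^ 6"
        by (simp add: powr_realpow[symmetric] powr_powr flip: powr_numeral)
      finally have "(5/3 :: real) \<le> 2 powr (5/6)" by (subst (asm) power_mono_iff) auto
      then have "t / 2 powr (5/6) \<le> t / (5/3)" using t1 by (intro divide_left_mono) auto
      then show ?thesis by simp
    qed
    finally have k': "real k \<le> 320015 * (t * (3/5))" using k(2) by linarith
    have "ic_splits ((E - F) \<union> ((F - F') \<union> F')) (k1 + (D + k))"
      using F'(1) by (intro ic_splits_Un F F' k) auto
    moreover have "(E - F) \<union> ((F - F') \<union> F') = E" using F F' by auto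
    \<comment> \<open>Removal and peeling cost at most \<open>128004 * t + 2\<close>, hence at most
      \<open>128006 * t\<close>; the constant solves \<open>C = 128006 + 3/5 * C\<close>.\<close>
    moreover have "real (k1 + (D + k)) \<le> 320015 * t" using k1 k' D t1 by simp
    ultimately show ?thesis unfolding t_def by metis
  qed
qed

text \<open>Peeling at degree \<open>t\<close> leaves at most \<open>2 * m / t\<close> vertices, and
  the exponent \<open>5/11\<close> solves \<open>a = 5/6 * (1 - a)\<close>, so that peeling and the
  vertex bound cost the same. Bounding \<open>2 powr (5/6)\<close> by 2 doubles the constant
  \<open>320015\<close>, and \<open>D \<le> 2 * t\<close> adds 2.\<close>

lemma ic_splits_edge_bound:
  assumes E: "simple_graph E" and m: "card E = m" "m > 0"
  shows "\<exists>k. ic_splits E k \<and> real k \<le> 640032 * real m powr (5/11)"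
proof -
  have finE: "finite E" "\<forall>e\<in>E. card e = 2" using E by (auto simp: simple_graph_def)
  define t where "t = real m powr (5/11)"
  have t1: "t \<ge> 1" unfolding t_def using m by (intro ge_one_powr_ge_zero) auto
  define D where "D = nat \<lceil>t\<rceil>"
  have D: "t \<le> D" "D \<le> t + 1" using t1 unfolding D_def by linarith+
  obtain F where F: "F \<subseteq> E" "\<forall>v\<in>\<Union>F. D < card {e\<in>F. v \<in> e}" "ic_splits (E - F) D"
    using core_decomposition[OF finE, of D] by (elim exE conjE)
  have finF: "finite F" "\<forall>e\<in>F. card e = 2" using F finE finite_subset by auto
  have "card (\<Union>F) * D \<le> 2 * card F" by (rule min_degree_vertex_bound[OF finF F(2)])
  also have "\<dots> \<le> 2 * m" using card_mono[OF finE(1) F(1)] m by simp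
  finally have "real (card (\<Union>F) * D) \<le> real (2 * m)" by (rule of_nat_mono)
  moreover have "real (card (\<Union>F)) * t \<le> real (card (\<Union>F)) * D"
    using D by (intro mult_left_mono) auto
  ultimately have "real (card (\<Union>F)) * t \<le> 2 * real m" by simp
  also have "real m = real m powr (6/11) * t"
    unfolding t_def using m by (simp flip: powr_add)
  finally have V: "real (card (\<Union>F)) \<le> 2 * real m powr (6/11)" using t1 by simp
  have "simple_graph F" using finF by (simp add: simple_graph_def)
  then obtain k where k: "ic_splits F k" "real k \<le> 320015 * real (card (\<Union>F)) powr (5/6)"
    using ic_splits_vertex_bound[of F "card (\<Union>F)"] by auto
  have "real (card (\<Union>F)) powr (5/6) \<le> (2 * real m powr (6/11)) powr (5/6)"
    using V by (intro powr_mono2) auto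
  also have "\<dots> = 2 powr (5/6) * t" unfolding t_def by (simp add: powr_mult powr_powr)
  also have "\<dots> \<le> 2 powr 1 * t" using t1 by (intro mult_right_mono powr_mono) auto
  finally have "real k \<le> 640030 * t" using k(2) by simp
  then have "real (D + k) \<le> 640032 * t" using D t1 by simp
  moreover have "ic_splits ((E - F) \<union> F) (D + k)" by (intro ic_splits_Un F k) auto
  moreover have "(E - F) \<union> F = E" using F by auto
  ultimately show ?thesis unfolding t_def by metis
qed

section \<open>Passing to the maxima over all graphs\<close>

lemma theta_v_bound: "real (theta_v n) \<le> 320015 * real n powr (5/6)"
proof -
  let ?S = "{E. simple_graph E \<and> (\<forall>e\<in>E. e \<subseteq> {0..<n})}"
  have "finite ?S" by (rule finite_subset[of _ "Pow (Pow {0..<n})"]) auto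
  moreover have "{} \<in> ?S" by (simp add: simple_graph_def)
  ultimately have "theta_v n \<in> ic_thickness ` ?S" unfolding theta_v_def by (intro Max_in) auto
  then obtain E where E: "simple_graph E" "\<forall>e\<in>E. e \<subseteq> {0..<n}" "theta_v n = ic_thickness E" by auto
  have "card (\<Union>E) \<le> card {0..<n}" using E by (intro card_mono) auto
  then obtain k where "ic_splits E k" "real k \<le> 320015 * real n powr (5/6)"
    using ic_splits_vertex_bound[OF E(1), of n] by auto
  then show ?thesis using ic_thickness_le[of E k] E(3) by linarith
qed

text \<open>Infinitely many graphs on the natural numbers have \<open>m\<close> edges, so the
  uniform bound on their thickness is also what makes the set under \<open>Max\<close>
  finite.\<close>

lemma theta_e_bound:
  assumes "m > 0"
  shows "real (theta_e m) \<le> 640032 * real m powr (5/11)"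
proof -
  let ?S = "{E. simple_graph E \<and> card E = m}"
  let ?c = "640032 * real m powr (5/11)"
  have bound: "real (ic_thickness E) \<le> ?c" if E: "E \<in> ?S" for E
  proof -
    obtain k where "ic_splits E k" "real k \<le> ?c"
      using ic_splits_edge_bound[of E m] E assms by auto
    then show ?thesis using ic_thickness_le[of E k] by linarith
  qed
  then have "ic_thickness ` ?S \<subseteq> {..nat \<lfloor>?c\<rfloor>}" by (auto simp: le_nat_floor)
  then have "finite (ic_thickness ` ?S)" by (rule finite_subset) simp
  \<comment> \<open>A star with \<open>m\<close> edges shows that the maximum is over a nonempty
    set.\<close>
  moreover have "(\<lambda>i. {0, Suc i}) ` {..<m} \<in> ?S"
  proof -
    have "inj_on (\<lambda>i. {0, Suc i}) {..<m}" by (auto simp: inj_on_def doubleton_eq_iff)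
    then show ?thesis by (auto simp: simple_graph_def card_image)
  qed
  ultimately have "theta_e m \<in> ic_thickness ` ?S" unfolding theta_e_def by (intro Max_in) blast+
  then show ?thesis using bound by auto
qed

text \<open>For \<open>n \<ge> 2\<close> the constant \<open>C\<close> equals \<open>n\<close> to
  the power \<open>ln C / ln n\<close>, and this exponent tends to 0.\<close>

lemma powr_bound_absorb_constant:
  fixes h :: "nat \<Rightarrow> nat" and a C :: real
  assumes "C > 0" and "\<And>n. n > 0 \<Longrightarrow> real (h n) \<le> C * real n powr a"
  shows "\<exists>f :: nat \<Rightarrow> real. (f \<longlongrightarrow> 0) at_top \<and>
            (\<forall>\<^sub>F n in at_top. real (h n) \<le> real n powr (a + f n))"
proof (intro exI[of _ "\<lambda>n. ln C / ln (real n)"] conjI)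
  have "filterlim (\<lambda>n. ln (real n)) at_top sequentially"
    by (rule filterlim_compose[OF ln_at_top filterlim_real_sequentially])
  then show "((\<lambda>n. ln C / ln (real n)) \<longlongrightarrow> 0) at_top"
    by (intro tendsto_divide_0[OF tendsto_const] filterlim_at_top_imp_at_infinity)
  have "real (h n) \<le> real n powr (a + ln C / ln (real n))" if "n \<ge> 2" for n
  proof -
    have "real n powr (ln C / ln (real n)) = C" using that assms(1) by (simp add: powr_def)
    then show ?thesis using assms(2)[of n] that by (simp add: powr_add mult.commute)
  qed
  then show "\<forall>\<^sub>F n in at_top. real (h n) \<le> real n powr (a + ln C / ln (real n))"
    unfolding eventually_at_top_linorder by blast
qed

theorem theorem1:
  shows "(\<exists>f :: nat \<Rightarrow> real. (f \<longlongrightarrow> 0) at_top \<and>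
            (\<forall>\<^sub>F n in at_top. real (theta_v n) \<le> real n powr (5/6 + f n))) \<and>
         (\<exists>g :: nat \<Rightarrow> real. (g \<longlongrightarrow> 0) at_top \<and>
            (\<forall>\<^sub>F m in at_top. real (theta_e m) \<le> real m powr (5/11 + g m)))"
  using powr_bound_absorb_constant[of 320015 theta_v "5/6"] theta_v_bound
    powr_bound_absorb_constant[of 640032 theta_e "5/11"] theta_e_bound
  by simp

end
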